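(* Let $q\colon M\to L$ be a compactification. Then $\mathcal E_0q$ is a trunc (i.e. is closed under all the trunc operations of $\mathcal R_0L$) if and only if every cozero element $u\in M$ such that $q(u)=\top$ is $C^*$-embedded in $M$.
   Context: A pointed frame is a frame $L$ with a frame homomorphism $*_L\colon L\to2=\{\bot,\top\}$; pointed frame homomorphisms are frame homomorphisms commuting with the points. $\mathcal O_*\mathbb R$, $\mathcal O_*\overline{\mathbb R}$ are the frames of open sets of $\mathbb R$ and $\overline{\mathbb R}=[-\infty,\infty]$ pointed by $0$ ($*(U)=\top$ iff $0\in U$); $p\colon\mathcal O_*\overline{\mathbb R}\to\mathcal O_*\mathbb R$ is $U\mapsto U\cap(-\infty,\infty)$. $\mathcal R_0L$ is the set of pointed frame homomorphisms $\mathcal O_*\mathbb R\to L$. It is an archimedean vector lattice with a truncation on its positive cone (a trunc), each trunc operation $w\colon\mathbb R^n\to\mathbb R$ (addition, scalar multiplication, $\vee$, $\wedge$, truncation $x\mapsto x\wedge1$) acting by $w(f_1,\dots,f_n)(V)=\bigvee\{\bigwedge_if_i(U_i):w(U_1\times\dots\times U_n)\subseteq V\}$. A compactification is a dense ($q(x)=\bot\Rightarrow x=\bot$) surjective pointed frame homomorphism $q\colon M\to L$ with $M$ compact regular. $\mathcal D_0M$ is the set of pointed frame homomorphisms $h'\colon\mathcal O_*\overline{\mathbb R}\to M$ such that $h'(-\infty,\infty)$ is a dense element of $M$ ($y$ is dense if $y\wedge x=\bot$ implies $x=\bot$). $\mathcal E_0q=\{h\in\mathcal R_0L:\exists h'\in\mathcal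 D_0M\ (q\circ h'=h\circ p)\}$. A cozero element of a frame $M$ is one of the form $g(\mathbb R\smallsetminus\{0\})$ for a frame homomorphism $g\colon\mathcal O\mathbb R\to M$. An element $u\in M$ is $C^*$-embedded if every frame homomorphism $\mathcal O[0,1]\to\{x\in M:x\le u\}$ factors through the open quotient map $M\to\{x\in M:x\le u\}$, $x\mapsto x\wedge u$. *)

theory Defs
  imports "HOL-Analysis.Analysis"
begin

section \<open>Frames\<close>

class frame = complete_lattice +
  assumes inf_Sup_frame: "inf a (Sup B) = (SUP b\<in>B. inf a b)"

instance set :: (type) frame
  by standard (rule inf_Sup)

instance bool :: frame
  by standard (rule inf_Sup)

text \<open>
  Some frames below (the opens of a space, the frame of elements below \<open>u\<close>) are not whole types.
  They are represented by a carrier set inside an ambient frame that is closed under all joins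
  and binary meets; its joins and binary meets are the ambient ones, its bottom is \<^term>\<open>bot\<close> and
  its top element is \<open>Sup A\<close>.
\<close>

definition frame_carrier :: "'a::frame set \<Rightarrow> bool" where
  "frame_carrier A \<longleftrightarrow> (\<forall>S\<subseteq>A. Sup S \<in> A) \<and> (\<forall>x\<in>A. \<forall>y\<in>A. inf x y \<in> A)"

definition frame_hom :: "'a::frame set \<Rightarrow> 'b::frame set \<Rightarrow> ('a \<Rightarrow> 'b) \<Rightarrow> bool" where
  "frame_hom A B f \<longleftrightarrow>
     f ` A \<subseteq> B \<and> f (Sup A) = Sup B \<and>
     (\<forall>x\<in>A. \<forall>y\<in>A. f (inf x y) = inf (f x) (f y)) \<and>
     (\<forall>S\<subseteq>A. f (Sup S) = Sup (f ` S))"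

definition opens :: "'x::topological_space set set" where
  "opens = {U. open U}"

definition opens_on :: "'x::topological_space set \<Rightarrow> 'x set set" where
  "opens_on X = {U. openin (top_of_set X) U}"

lemma frame_carrier_UNIV: "frame_carrier UNIV"
  by (simp add: frame_carrier_def)

lemma frame_carrier_atMost: "frame_carrier {..u}" "Sup {..u} = u"
  by (auto simp: frame_carrier_def intro: Sup_least le_infI1 antisym Sup_upper)

lemma frame_carrier_opens: "frame_carrier opens" "Sup opens = UNIV"
  by (auto simp: frame_carrier_def opens_def)

lemma frame_carrier_opens_on: "frame_carrier (opens_on X)" "Sup (opens_on X) = X"
proof -
  have "openin (top_of_set X) X" by simp
  then show "Sup (opens_on X) = X"
    unfolding opens_on_def using openin_imp_subset by blast
qed (auto simp: frame_carrier_def opens_on_def)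


section \<open>Pointed frames\<close>

text \<open>The two-element frame is \<^typ>\<open>bool\<close>.\<close>

definition frame_point :: "('l::frame \<Rightarrow> bool) \<Rightarrow> bool" where
  "frame_point p \<longleftrightarrow> frame_hom UNIV UNIV p"

definition pointed_frame_hom ::
  "'a::frame set \<Rightarrow> ('a \<Rightarrow> bool) \<Rightarrow> 'b::frame set \<Rightarrow> ('b \<Rightarrow> bool) \<Rightarrow> ('a \<Rightarrow> 'b) \<Rightarrow> bool" where
  "pointed_frame_hom A p B r f \<longleftrightarrow> frame_hom A B f \<and> (\<forall>x\<in>A. r (f x) = p x)"

definition zero_point :: "'x::zero set \<Rightarrow> bool" where
  "zero_point U \<longleftrightarrow> 0 \<in> U"


section \<open>The trunc of a pointed frame\<close>

text \<open>Frame homomorphisms out of a frame of opens are made extensional, so that they are equal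
  as functions exactly if they agree on all open sets.\<close>

definition R0 :: "('l::frame \<Rightarrow> bool) \<Rightarrow> (real set \<Rightarrow> 'l) set" where
  "R0 p = {h \<in> extensional opens. pointed_frame_hom opens zero_point UNIV p h}"

text \<open>An operation \<open>\<real>\<^sup>n \<rightarrow> \<real>\<close> is a function of type \<^typ>\<open>(nat \<Rightarrow> real) \<Rightarrow> real\<close> together with its arity
  \<open>n\<close>; only the coordinates \<open>i < n\<close> of its argument matter. The zero vector is the nullary
  operation.\<close>

inductive trunc_op :: "nat \<Rightarrow> ((nat \<Rightarrow> real) \<Rightarrow> real) \<Rightarrow> bool" where
  trunc_op_zero: "trunc_op 0 (\<lambda>x. 0)"
| trunc_op_add: "trunc_op 2 (\<lambda>x. x 0 + x 1)"
| trunc_op_scale: "trunc_op 1 (\<lambda>x. c * x 0)"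
| trunc_op_sup: "trunc_op 2 (\<lambda>x. max (x 0) (x 1))"
| trunc_op_inf: "trunc_op 2 (\<lambda>x. min (x 0) (x 1))"
| trunc_op_trunc: "trunc_op 1 (\<lambda>x. min (x 0) 1)"

definition lift_op ::
  "nat \<Rightarrow> ((nat \<Rightarrow> real) \<Rightarrow> real) \<Rightarrow> (nat \<Rightarrow> real set \<Rightarrow> 'l::frame) \<Rightarrow> real set \<Rightarrow> 'l" where
  "lift_op n w f =
     (\<lambda>V\<in>opens. Sup {INF i\<in>{..<n}. f i (U i) | U.
        (\<forall>i<n. U i \<in> opens) \<and> w ` (PiE {..<n} U) \<subseteq> V})"

definition trunc_closed :: "(real set \<Rightarrow> 'l::frame) set \<Rightarrow> bool" where
  "trunc_closed E \<longleftrightarrow>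
     (\<forall>n w f. trunc_op n w \<longrightarrow> (\<forall>i<n. f i \<in> E) \<longrightarrow> lift_op n w f \<in> E)"


section \<open>Compactifications\<close>

definition dense_element :: "'m::frame \<Rightarrow> bool" where
  "dense_element y \<longleftrightarrow> (\<forall>x. inf y x = bot \<longrightarrow> x = bot)"

definition dense_hom :: "('m::frame \<Rightarrow> 'l::frame) \<Rightarrow> bool" where
  "dense_hom q \<longleftrightarrow> (\<forall>x. q x = bot \<longrightarrow> x = bot)"

definition compact_frame :: "'m::frame itself \<Rightarrow> bool" where
  "compact_frame _ \<longleftrightarrow>
     (\<forall>S::'m set. Sup S = top \<longrightarrow> (\<exists>F\<subseteq>S. finite F \<and> Sup F = top))"

definition rather_below :: "'m::frame \<Rightarrow> 'm \<Rightarrow> bool" where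
  "rather_below y x \<longleftrightarrow> (\<exists>z. inf y z = bot \<and> sup z x = top)"

definition regular_frame :: "'m::frame itself \<Rightarrow> bool" where
  "regular_frame _ \<longleftrightarrow> (\<forall>x::'m. x = Sup {y. rather_below y x})"

definition compactification ::
  "('m::frame \<Rightarrow> bool) \<Rightarrow> ('l::frame \<Rightarrow> bool) \<Rightarrow> ('m \<Rightarrow> 'l) \<Rightarrow> bool" where
  "compactification pM pL q \<longleftrightarrow>
     pointed_frame_hom UNIV pM UNIV pL q \<and> dense_hom q \<and> surj q \<and>
     compact_frame TYPE('m) \<and> regular_frame TYPE('m)"

definition D0 :: "('m::frame \<Rightarrow> bool) \<Rightarrow> (ereal set \<Rightarrow> 'm) set" where
  "D0 p = {h \<in> extensional opens. pointed_frame_hom opens zero_point UNIV p h \<and>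
     dense_element (h {-\<infinity><..<\<infinity>})}"

text \<open>The restriction of opens of the extended reals to opens of the reals.\<close>

definition restr_real :: "ereal set \<Rightarrow> real set" where
  "restr_real U = ereal -` U"

definition E0 ::
  "('m::frame \<Rightarrow> bool) \<Rightarrow> ('l::frame \<Rightarrow> bool) \<Rightarrow> ('m \<Rightarrow> 'l) \<Rightarrow> (real set \<Rightarrow> 'l) set" where
  "E0 pM pL q =
     {h \<in> R0 pL. \<exists>h'\<in>D0 pM. \<forall>U\<in>opens. q (h' U) = h (restr_real U)}"


section \<open>Cozero and C*-embedded elements\<close>

definition cozero_element :: "'m::frame \<Rightarrow> bool" where
  "cozero_element u \<longleftrightarrow>
     (\<exists>g :: real set \<Rightarrow> 'm. frame_hom opens UNIV g \<and> u = g (UNIV - {0}))"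

definition Cstar_embedded :: "'m::frame \<Rightarrow> bool" where
  "Cstar_embedded u \<longleftrightarrow>
     (\<forall>f. frame_hom (opens_on {0..1::real}) {..u} f \<longrightarrow>
        (\<exists>g. frame_hom (opens_on {0..1::real}) UNIV g \<and>
             (\<forall>U\<in>opens_on {0..1}. f U = inf (g U) u)))"

end

theory Submission
  imports Defs
begin

text \<open>
  A compact regular frame has enough points, so \<open>M\<close> is the frame of opens of a space, and frame
  homomorphisms from the opens of a Hausdorff space into \<open>M\<close> are continuous maps. An element of
  \<open>\<E>\<^sub>0 q\<close> becomes an extended real function \<open>\<phi>\<close> on that space, vanishing at the base point, whose
  finiteness set is mapped to the top element by \<open>q\<close>.

  If the cozero elements in question are \<open>C*\<close>-embedded, an operation \<open>w\<close> is applied to such functions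
  on the cozero set where all of them are finite; squashing the result into \<open>[0,1]\<close> makes it
  extendable, and unsquashing the extension gives a function with values in \<open>[-\<infinity>,\<infinity>]\<close>.

  Conversely, let \<open>u\<close> be the cozero set of \<open>c\<close> and \<open>f\<close> a function from \<open>u\<close> to \<open>[0,1]\<close>. Both
  \<open>1/|c| + f\<close> and \<open>1/|c|\<close> extend continuously by \<open>\<infinity>\<close> outside \<open>u\<close>. After normalisation at the base
  point, closure under addition extends their difference, which by density of \<open>q\<close> is \<open>f\<close> on \<open>u\<close>
  up to a constant; the extension is then clamped.
\<close>

section \<open>Frame homomorphisms and points\<close>

lemma inf_sup_frame: "inf a (sup b c) = sup (inf a b) (inf a c)" for a :: "'a::frame"
  using inf_Sup_frame[of a "{b, c}"] by simp

lemma frame_homD: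
  assumes "frame_hom UNIV UNIV f"
  shows "f top = top" "f (inf a b) = inf (f a) (f b)" "f (Sup S) = Sup (f ` S)"
    "f bot = bot" "a \<le> b \<Longrightarrow> f a \<le> f b"
proof -
  show 1: "f top = top" "f (inf a b) = inf (f a) (f b)" "f (Sup S) = Sup (f ` S)" for a b S
    using assms by (auto simp: frame_hom_def)
  show "f bot = bot" using 1(3)[of "{}"] by simp
  show "a \<le> b \<Longrightarrow> f a \<le> f b" using 1(2)[of a b] by (metis inf.absorb1 inf.cobounded2)
qed

lemma frame_hom_finite_INF:
  assumes "frame_hom UNIV UNIV q" "finite I"
  shows "q (INF i\<in>I. a i) = (INF i\<in>I. q (a i))"
  using assms(2) by induction (simp_all add: frame_homD[OF assms(1)])

lemma frame_pointD:
  assumes "frame_point x"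
  shows "x top" "x (inf a b) \<longleftrightarrow> x a \<and> x b" "x (Sup S) \<longleftrightarrow> (\<exists>s\<in>S. x s)"
    "\<not> x bot" "a \<le> b \<Longrightarrow> x a \<Longrightarrow> x b"
  using frame_homD[OF assms[unfolded frame_point_def]] by auto

text \<open>By distributivity a maximal proper element is prime: if neither \<open>c\<close> nor
  \<open>d\<close> is below \<open>m\<close>, then \<open>sup m c = top\<close>, and distributing
  \<open>d\<close> over this join puts \<open>d\<close> below \<open>m\<close> as soon as
  \<open>inf c d\<close> is. Not lying below \<open>m\<close> respects all joins, so primeness is
  all that a point requires.\<close>

lemma maximal_frame_point:
  fixes m :: "'m::frame"
  assumes "m \<noteq> top" and max: "\<And>c. m \<le> c \<Longrightarrow> c \<noteq> top \<Longrightarrow> c = m"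
  shows "frame_point (\<lambda>c. \<not> c \<le> m)"
proof -
  have "\<not> inf c d \<le> m" if "\<not> c \<le> m" "\<not> d \<le> m" for c d
  proof
    assume le: "inf c d \<le> m"
    have c: "sup m c = top"
      using max[of "sup m c"] that(1) by (metis sup_ge1 sup_ge2)
    have "d = sup (inf d m) (inf d c)"
      using c inf_sup_frame[of d m c] by simp
    also have "\<dots> \<le> m" using le by (simp add: inf_commute)
    finally show False using that by blast
  qed
  moreover have "\<not> (top \<le> m)" using assms(1) top_le by blast
  ultimately show ?thesis
    by (auto simp: frame_point_def frame_hom_def Sup_le_iff intro: le_infI1 le_infI2)
qed

lemma finite_chain_Sup:
  fixes F :: "'a::complete_lattice set"
  assumes "finite F" "F \<noteq> {}" "\<And>a b. a \<in> F \<Longrightarrow> b \<in> F \<Longrightarrow> a \<le> b \<or> b \<le> a"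
  shows "Sup F \<in> F"
  using assms
proof (induction rule: finite_ne_induct)
  case (insert x F)
  then have "Sup F \<in> F" by simp
  with insert.prems[of x "Sup F"] show ?case by (auto simp: sup_absorb1 sup_absorb2)
qed simp

text \<open>Zorn's lemma is applied to the proper elements above \<open>m\<close>; by compactness a
  chain of them cannot have join \<open>top\<close>. The maximal element \<open>n\<close> gives the
  point. The last conjunct holds because \<open>c\<close> below \<open>n\<close> would force
  \<open>sup m c\<close> below \<open>n\<close>.\<close>

lemma compact_frame_point:
  fixes m :: "'m::frame"
  assumes "compact_frame TYPE('m)" "m \<noteq> top"
  shows "\<exists>x. frame_point x \<and> \<not> x m \<and> (\<forall>c. sup m c = top \<longrightarrow> x c)"
proof -
  define A where "A = {c. m \<le> c \<and> c \<noteq> top}"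
  have po: "partial_order_on A (relation_of (\<le>) A)"
    by (auto simp: partial_order_on_def preorder_on_def refl_on_def trans_def antisym_def
        relation_of_def)
  have "\<exists>u\<in>A. \<forall>a\<in>C. a \<le> u" if C: "C \<in> Chains (relation_of (\<le>) A)" for C
  proof (cases "C = {}")
    case True
    then show ?thesis using assms(2) by (auto simp: A_def)
  next
    case False
    have sub: "C \<subseteq> A" and ch: "\<And>a b. a \<in> C \<Longrightarrow> b \<in> C \<Longrightarrow> a \<le> b \<or> b \<le> a"
      using C by (auto simp: Chains_def relation_of_def)
    have "Sup C \<noteq> top"
    proof
      assume "Sup C = top"
      then obtain F where F: "F \<subseteq> C" "finite F" "Sup F = top"
        using assms(1) unfolding compact_frame_def by blast
      have "F \<noteq> {}" using F(3) assms(2) by (metis Sup_empty bot.extremum_uniqueI top_greatest)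
      then have "Sup F \<in> F" using F ch by (intro finite_chain_Sup) blast+
      then show False using F sub by (auto simp: A_def)
    qed
    moreover have "m \<le> Sup C" using False sub by (auto simp: A_def intro: Sup_upper2)
    ultimately show ?thesis by (auto simp: A_def Sup_upper)
  qed
  then obtain n where n: "n \<in> A" "\<And>c. c \<in> A \<Longrightarrow> n \<le> c \<Longrightarrow> c = n"
    using predicate_Zorn[of A "(\<le>)"] po by blast
  have "frame_point (\<lambda>c. \<not> c \<le> n)"
    using n by (intro maximal_frame_point) (auto simp: A_def)
  moreover have "\<not> c \<le> n" if "sup m c = top" for c
    using that n(1) by (auto simp: A_def) (metis le_sup_iff top_le)
  ultimately show ?thesis using n(1) by (intro exI[of _ "\<lambda>c. \<not> c \<le> n"]) (auto simp: A_def)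
qed

section \<open>The space of points\<close>

definition spectrum :: "'m::frame \<Rightarrow> ('m \<Rightarrow> bool) set" where
  "spectrum a = {x. frame_point x \<and> x a}"

text \<open>A value of type \<open>topology\<close> is used because the points are only some of the
  functions into \<open>bool\<close>, and that function type already carries its product
  topology.\<close>

definition spectral_topology :: "('m::frame \<Rightarrow> bool) topology" where
  "spectral_topology = topology (\<lambda>U. \<exists>a. U = spectrum a)"

lemma spectrum_bot [simp]: "spectrum bot = {}"
  and spectrum_inf: "spectrum (inf a b) = spectrum a \<inter> spectrum b"
  and spectrum_Sup: "spectrum (Sup S) = (\<Union>a\<in>S. spectrum a)"
  and spectrum_top: "spectrum top = Collect frame_point"
  by (auto simp: spectrum_def frame_pointD)

lemma spectrum_mono: "a \<le> b \<Longrightarrow> spectrum a \<subseteq> spectrum b"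
  by (auto simp: spectrum_def intro: frame_pointD(5))

lemma openin_spectral_topology: "openin spectral_topology U \<longleftrightarrow> (\<exists>a. U = spectrum a)"
proof -
  have "istopology (\<lambda>U. \<exists>a::'a. U = spectrum a)"
    unfolding istopology_def
  proof (intro conjI allI impI)
    fix K :: "('a \<Rightarrow> bool) set set"
    assume "\<forall>U\<in>K. \<exists>a. U = spectrum a"
    then obtain a where "\<forall>U\<in>K. U = spectrum (a U)" by metis
    then have "\<Union>K = spectrum (Sup (a ` K))" by (auto simp: spectrum_Sup)
    then show "\<exists>b. \<Union>K = spectrum b" ..
  qed (metis spectrum_inf)
  then show ?thesis by (simp add: spectral_topology_def topology_inverse')
qed

lemma topspace_spectral_topology [simp]: "topspace spectral_topology = spectrum top"
  by (metis openin_spectral_topology openin_subset openin_topspace spectrum_mono subset_antisym top_greatest)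

lemma openin_spectrum [simp]: "openin spectral_topology (spectrum a)"
  by (auto simp: openin_spectral_topology)

lemma spectrum_subset: "spectrum a \<subseteq> spectrum top"
  by (simp add: spectrum_mono)

lemma spectrum_top_Int [simp]: "spectrum top \<inter> spectrum a = spectrum a"
  using spectrum_subset by (rule inf_absorb2)

lemma subtopology_spectrum_top [simp]:
  "subtopology spectral_topology (spectrum top) = spectral_topology"
  by (metis subtopology_topspace topspace_spectral_topology)

lemma spectrum_finite_INF:
  "finite I \<Longrightarrow> spectrum (INF i\<in>I. a i) = {x \<in> spectrum top. \<forall>i\<in>I. x \<in> spectrum (a i)}"
proof (induction rule: finite_induct)
  case (insert i I)
  then show ?case using spectrum_subset[of "a i"] by (auto simp: spectrum_inf)
qed simp

text \<open>This turns open sets of points back into elements. It is a right inverse of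
  \<open>spectrum\<close> on open sets, and a two-sided inverse once the frame has enough
  points.\<close>

definition spectral_interior :: "('m::frame \<Rightarrow> bool) set \<Rightarrow> 'm" where
  "spectral_interior W = Sup {a. spectrum a \<subseteq> W}"

lemma spectrum_spectral_interior:
  "openin spectral_topology W \<Longrightarrow> spectrum (spectral_interior W) = W"
  by (auto simp: spectral_interior_def spectrum_Sup openin_spectral_topology)

section \<open>Spatiality of compact regular frames\<close>

locale compact_regular_frame =
  fixes M :: "'m::frame itself"
  assumes compact: "compact_frame M" and regular: "regular_frame M"
begin

text \<open>By regularity it suffices to treat \<open>y\<close> rather below \<open>a\<close>,
  witnessed by \<open>z\<close>. If \<open>sup b z\<close> were proper, there would be a point
  outside it that lies in everything complementing it to \<open>top\<close>, hence in
  \<open>a\<close> but not in \<open>b\<close>. So \<open>sup b z = top\<close>, and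
  \<open>y\<close>, being disjoint from \<open>z\<close>, is below \<open>b\<close>.\<close>

lemma spectrum_le_iff: "spectrum a \<subseteq> spectrum b \<longleftrightarrow> a \<le> b" for a b :: 'm
proof
  assume sub: "spectrum a \<subseteq> spectrum b"
  have "y \<le> b" if "rather_below y a" for y
  proof -
    obtain z where z: "inf y z = bot" "sup z a = top"
      using \<open>rather_below y a\<close> by (auto simp: rather_below_def)
    have "sup b z = top"
    proof (rule ccontr)
      assume "sup b z \<noteq> top"
      then obtain x where x: "frame_point x" "\<not> x (sup b z)" "\<And>c. sup (sup b z) c = top \<Longrightarrow> x c"
        using compact_frame_point compact unfolding compact_frame_def by metis
      have "x a" using z(2) by (intro x(3)) (simp add: sup_assoc)
      then have "x b" using sub x(1) by (auto simp: spectrum_def)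
      then show False using x(1,2) frame_pointD(5) sup_ge1 by blast
    qed
    then have "y = inf y (sup b z)" by simp
    also have "\<dots> \<le> b" using z(1) by (simp add: inf_sup_frame)
    finally show "y \<le> b" .
  qed
  moreover have "a = Sup {y. rather_below y a}"
    using regular by (simp add: regular_frame_def)
  ultimately show "a \<le> b" by (metis (no_types, lifting) Sup_least mem_Collect_eq)
qed (rule spectrum_mono)

lemma spectrum_eq_iff: "spectrum a = spectrum b \<longleftrightarrow> a = b" for a b :: 'm
  using spectrum_le_iff[of a b] spectrum_le_iff[of b a] by (auto intro: antisym)

end

section \<open>Frame homomorphisms as continuous maps\<close>

text \<open>Hausdorff spaces are sober. The largest open set \<open>W\<close> sent to
  \<open>False\<close> determines \<open>k\<close>: an open set is sent to \<open>True\<close> iff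
  it is not inside \<open>W\<close>. Two points outside \<open>W\<close> would have disjoint
  neighbourhoods both sent to \<open>True\<close>, so \<open>W\<close> misses exactly one point of
  \<open>Y\<close>.\<close>

lemma sober_t2:
  fixes Y :: "'t::t2_space set"
  assumes k: "frame_hom (opens_on Y) (UNIV :: bool set) k"
  shows "\<exists>y\<in>Y. \<forall>U\<in>opens_on Y. k U \<longleftrightarrow> y \<in> U"
proof -
  have [simp]: "k Y" using k frame_carrier_opens_on(2)[of Y] by (auto simp: frame_hom_def)
  have inf: "k (U \<inter> V) \<longleftrightarrow> k U \<and> k V" if "U \<in> opens_on Y" "V \<in> opens_on Y" for U V
    using k that by (auto simp: frame_hom_def)
  have Sup: "k (\<Union>S) \<longleftrightarrow> (\<exists>U\<in>S. k U)" if "S \<subseteq> opens_on Y" for S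
    using k that by (auto simp: frame_hom_def)
  define W where "W = \<Union>{U \<in> opens_on Y. \<not> k U}"
  have kW: "\<not> k W" unfolding W_def by (subst Sup) auto
  have oW: "W \<in> opens_on Y" by (auto simp: W_def opens_on_def)
  have kiff: "k U \<longleftrightarrow> \<not> U \<subseteq> W" if "U \<in> opens_on Y" for U
  proof
    assume "k U"
    then show "\<not> U \<subseteq> W" using inf[OF that oW] kW by (auto simp: inf_absorb1)
  qed (use that in \<open>auto simp: W_def\<close>)
  have "Y \<in> opens_on Y" by (simp add: opens_on_def)
  then obtain y where y: "y \<in> Y" "y \<notin> W" using kiff[of Y] by auto
  have uniq: "z = y" if "z \<in> Y" "z \<notin> W" for z
  proof (rule ccontr)
    assume "z \<noteq> y"
    then obtain U V where UV: "open U" "open V" "z \<in> U" "y \<in> V" "U \<inter> V = {}"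
      by (meson hausdorff)
    have o: "Y \<inter> U \<in> opens_on Y" "Y \<inter> V \<in> opens_on Y"
      using UV by (auto simp: opens_on_def openin_open)
    then have "k (Y \<inter> U)" "k (Y \<inter> V)" using kiff UV that y by blast+
    moreover have "(Y \<inter> U) \<inter> (Y \<inter> V) = {}" using UV by blast
    ultimately have "k {}" using inf[OF o] by simp
    then show False using Sup[of "{}"] by simp
  qed
  have "k U \<longleftrightarrow> y \<in> U" if "U \<in> opens_on Y" for U
  proof -
    have "U \<subseteq> Y" using that openin_imp_subset by (auto simp: opens_on_def)
    then show ?thesis using kiff[OF that] uniq y by blast
  qed
  with y show ?thesis by blast
qed

lemma opens_on_UNIV: "opens_on UNIV = opens"
  by (auto simp: opens_on_def opens_def)

text \<open>Composing \<open>f\<close> with a point of \<open>spectrum u\<close> gives a frame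
  homomorphism into \<open>bool\<close>, which by sobriety is membership of a single point of
  \<open>Y\<close>. That point is the value of \<open>\<phi>\<close>, and the formula for
  \<open>spectrum (f U)\<close> yields continuity.\<close>

lemma continuous_map_of_frame_hom:
  fixes Y :: "'t::t2_space set"
  assumes f: "frame_hom (opens_on Y) {..u} f"
  shows "\<exists>\<phi>. continuous_map (subtopology spectral_topology (spectrum u)) (top_of_set Y) \<phi> \<and>
    (\<forall>U\<in>opens_on Y. spectrum (f U) = {x \<in> spectrum u. \<phi> x \<in> U})"
proof -
  have "\<exists>y. y \<in> Y \<and> (\<forall>U\<in>opens_on Y. x (f U) \<longleftrightarrow> y \<in> U)" if x: "x \<in> spectrum u" for x
  proof -
    have "frame_hom (opens_on Y) UNIV (\<lambda>U. x (f U))"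
      unfolding frame_hom_def
    proof (intro conjI ballI allI impI)
      show "x (f (Sup (opens_on Y))) = Sup UNIV"
        using x f by (simp add: frame_hom_def frame_carrier_atMost spectrum_def)
      show "x (f (inf U V)) = inf (x (f U)) (x (f V))" if "U \<in> opens_on Y" "V \<in> opens_on Y" for U V
        using x f that by (simp add: frame_hom_def spectrum_def frame_pointD)
      show "x (f (Sup S)) = Sup ((\<lambda>U. x (f U)) ` S)" if "S \<subseteq> opens_on Y" for S
        using x f that by (auto simp: frame_hom_def spectrum_def frame_pointD)
    qed simp
    then show ?thesis using sober_t2 by blast
  qed
  then obtain \<phi> where \<phi>: "\<And>x. x \<in> spectrum u \<Longrightarrow> \<phi> x \<in> Y"
    "\<And>x U. x \<in> spectrum u \<Longrightarrow> U \<in> opens_on Y \<Longrightarrow> x (f U) \<longleftrightarrow> \<phi> x \<in> U" by metis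
  have sp: "spectrum (f U) = {x \<in> spectrum u. \<phi> x \<in> U}" if "U \<in> opens_on Y" for U
  proof -
    have "f U \<le> u" using f that by (auto simp: frame_hom_def)
    then have "spectrum (f U) \<subseteq> spectrum u" by (rule spectrum_mono)
    with \<phi>(2)[OF _ that] show ?thesis by (auto simp: spectrum_def)
  qed
  have "continuous_map (subtopology spectral_topology (spectrum u)) (top_of_set Y) \<phi>"
    unfolding continuous_map_def
  proof (intro conjI allI impI)
    fix U assume "openin (top_of_set Y) U"
    then have "U \<in> opens_on Y" by (simp add: opens_on_def)
    then have "{x \<in> spectrum u. \<phi> x \<in> U} = spectrum (f U)" using sp by blast
    then show "openin (subtopology spectral_topology (spectrum u))
        {x \<in> topspace (subtopology spectral_topology (spectrum u)). \<phi> x \<in> U}"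
      by (auto simp: inf_absorb2 openin_open_subtopology spectrum_mono)
  qed (use \<phi>(1) in auto)
  with sp show ?thesis by blast
qed

lemma openin_spectrum_preimage:
  assumes "continuous_map (subtopology spectral_topology (spectrum u)) (top_of_set Y) \<phi>"
    and "U \<in> opens_on Y"
  shows "openin spectral_topology {x \<in> spectrum u. \<phi> x \<in> U}"
  using openin_continuous_map_preimage[OF assms(1), of U] assms(2)
  by (simp add: opens_on_def openin_open_subtopology)

context compact_regular_frame
begin

lemma spectral_interior_spectrum [simp]: "spectral_interior (spectrum a) = a" for a :: 'm
  using spectrum_eq_iff spectrum_spectral_interior openin_spectrum by blast

text \<open>Preimages commute with unions and intersections, and \<open>spectrum\<close> is
  injective here, so every identity between elements can be checked on sets of points.\<close>

lemma frame_hom_of_continuous_map: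
  fixes u :: 'm
  assumes \<phi>: "continuous_map (subtopology spectral_topology (spectrum u)) (top_of_set Y) \<phi>"
  shows "frame_hom (opens_on Y) {..u} (\<lambda>U. spectral_interior {x \<in> spectrum u. \<phi> x \<in> U})"
    (is "frame_hom _ _ ?f")
proof -
  have sp: "spectrum (?f U) = {x \<in> spectrum u. \<phi> x \<in> U}" if "U \<in> opens_on Y" for U
    using spectrum_spectral_interior openin_spectrum_preimage[OF \<phi> that] by blast
  have op: "Sup S \<in> opens_on Y" if "S \<subseteq> opens_on Y" for S
    using that frame_carrier_opens_on(1)[of Y] by (simp add: frame_carrier_def)
  have op2: "inf U V \<in> opens_on Y" if "U \<in> opens_on Y" "V \<in> opens_on Y" for U V
    using that frame_carrier_opens_on(1)[of Y] unfolding frame_carrier_def by blast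
  show ?thesis
    unfolding frame_hom_def
  proof (intro conjI ballI allI impI)
    show "?f ` opens_on Y \<subseteq> {..u}"
      by (auto simp: spectrum_le_iff[symmetric] sp)
    have "\<phi> x \<in> Y" if "x \<in> spectrum u" for x
      using continuous_map_image_subset_topspace[OF \<phi>] that by auto
    moreover have "Y \<in> opens_on Y" by (simp add: opens_on_def)
    ultimately show "?f (Sup (opens_on Y)) = Sup {..u}"
      by (subst spectrum_eq_iff[symmetric])
        (auto simp: frame_carrier_opens_on(2) frame_carrier_atMost sp)
    show "?f (inf U V) = inf (?f U) (?f V)" if "U \<in> opens_on Y" "V \<in> opens_on Y" for U V
      by (subst spectrum_eq_iff[symmetric], unfold spectrum_inf sp[OF op2[OF that]])
        (use that in \<open>auto simp: sp\<close>)
    show "?f (Sup S) = Sup (?f ` S)" if "S \<subseteq> opens_on Y" for S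
    proof (subst spectrum_eq_iff[symmetric])
      have "spectrum (Sup (?f ` S)) = (\<Union>U\<in>S. {x \<in> spectrum u. \<phi> x \<in> U})"
        using sp that by (auto simp: spectrum_Sup)
      then show "spectrum (?f (Sup S)) = spectrum (Sup (?f ` S))"
        using sp[OF op[OF that]] by auto
    qed
  qed
qed

section \<open>Cozero and C*-embedded elements in terms of functions\<close>

lemma cozero_element_iff:
  fixes u :: 'm
  shows "cozero_element u \<longleftrightarrow>
    (\<exists>c. continuous_map spectral_topology euclideanreal c \<and> spectrum u = {x \<in> spectrum top. c x \<noteq> 0})"
proof
  assume "cozero_element u"
  then obtain g :: "real set \<Rightarrow> 'm" where g: "frame_hom opens UNIV g" "u = g (UNIV - {0})"
    unfolding cozero_element_def by blast
  from g(1) have "frame_hom (opens_on UNIV) {..top} g" by (simp add: opens_on_UNIV atMost_def)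
  from continuous_map_of_frame_hom[OF this] obtain c where
    "continuous_map spectral_topology euclideanreal c"
    "\<forall>U\<in>opens. spectrum (g U) = {x \<in> spectrum top. c x \<in> U}"
    by (auto simp: opens_on_UNIV)
  moreover have "UNIV - {0::real} \<in> opens" by (simp add: opens_def open_delete)
  ultimately show "\<exists>c. continuous_map spectral_topology euclideanreal c \<and>
      spectrum u = {x \<in> spectrum top. c x \<noteq> 0}"
    using g(2) by (intro exI[of _ c]) simp
next
  assume "\<exists>c. continuous_map spectral_topology euclideanreal c \<and>
    spectrum u = {x \<in> spectrum top. c x \<noteq> 0}"
  then obtain c where c: "continuous_map spectral_topology euclideanreal c"
    "{x \<in> spectrum top. c x \<noteq> 0} = spectrum u" by auto
  have "frame_hom opens UNIV (\<lambda>U. spectral_interior {x \<in> spectrum top. c x \<in> U} :: 'm)"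
    using frame_hom_of_continuous_map[of top UNIV c] c(1) by (simp add: opens_on_UNIV atMost_def)
  moreover have "u = spectral_interior {x \<in> spectrum top. c x \<in> UNIV - {0}}"
    using c(2) by simp
  ultimately show "cozero_element u"
    unfolding cozero_element_def
    by (intro exI[of _ "\<lambda>U. spectral_interior {x \<in> spectrum top. c x \<in> U}"] conjI)
qed

text \<open>Both directions pass between homomorphisms and functions. Meeting with \<open>u\<close>
  corresponds to restricting a function to \<open>spectrum u\<close>.\<close>

lemma Cstar_embedded_iff:
  fixes u :: 'm
  shows "Cstar_embedded u \<longleftrightarrow>
    (\<forall>\<phi>. continuous_map (subtopology spectral_topology (spectrum u)) (top_of_set {0..1::real}) \<phi> \<longrightarrow>
      (\<exists>\<psi>. continuous_map spectral_topology (top_of_set {0..1}) \<psi> \<and> (\<forall>x\<in>spectrum u. \<psi> x = \<phi> x)))"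
    (is "_ \<longleftrightarrow> ?ext")
proof
  assume emb: "Cstar_embedded u"
  show ?ext
  proof (intro allI impI)
    fix \<phi> :: "('m \<Rightarrow> bool) \<Rightarrow> real"
    assume \<phi>: "continuous_map (subtopology spectral_topology (spectrum u)) (top_of_set {0..1}) \<phi>"
    obtain g where g: "frame_hom (opens_on {0..1}) {..top} g" and
      gu: "\<And>U. U \<in> opens_on {0..1} \<Longrightarrow>
        spectral_interior {x \<in> spectrum u. \<phi> x \<in> U} = inf (g U) u"
      using emb frame_hom_of_continuous_map[OF \<phi>] unfolding Cstar_embedded_def
      by (auto simp: atMost_def)
    obtain \<psi> where \<psi>: "continuous_map spectral_topology (top_of_set {0..1}) \<psi>"
      "\<And>U. U \<in> opens_on {0..1} \<Longrightarrow> spectrum (g U) = {x \<in> spectrum top. \<psi> x \<in> U}"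
      using continuous_map_of_frame_hom[OF g] by auto
    have "\<psi> x = \<phi> x" if x: "x \<in> spectrum u" for x
    proof (rule ccontr)
      assume ne: "\<psi> x \<noteq> \<phi> x"
      \<comment> \<open>This open set contains \<open>\<psi> x\<close> but not
        \<open>\<phi> x\<close>, although both functions must have the same preimage of it within
        \<open>spectrum u\<close>.\<close>
      have U: "{0..1} - {\<phi> x} \<in> opens_on {0..1}"
        by (simp add: opens_on_def openin_delete)
      have xt: "x \<in> spectrum top" using x spectrum_subset by blast
      then have "\<psi> x \<in> {0..1}" using continuous_map_image_subset_topspace[OF \<psi>(1)] by auto
      then have "x \<in> spectrum (inf (g ({0..1} - {\<phi> x})) u)"
        using ne x xt by (auto simp: spectrum_inf \<psi>(2)[OF U])
      then have "x \<in> {y \<in> spectrum u. \<phi> y \<in> {0..1} - {\<phi> x}}"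
        unfolding gu[OF U, symmetric]
          spectrum_spectral_interior[OF openin_spectrum_preimage[OF \<phi> U]] .
      then show False by simp
    qed
    with \<psi>(1) show "\<exists>\<psi>. continuous_map spectral_topology (top_of_set {0..1}) \<psi> \<and>
        (\<forall>x\<in>spectrum u. \<psi> x = \<phi> x)" by blast
  qed
next
  assume ext: ?ext
  show "Cstar_embedded u"
    unfolding Cstar_embedded_def
  proof (intro allI impI)
    fix f assume f: "frame_hom (opens_on {0..1::real}) {..u} f"
    obtain \<phi> where \<phi>: "continuous_map (subtopology spectral_topology (spectrum u)) (top_of_set {0..1}) \<phi>"
      "\<And>U. U \<in> opens_on {0..1} \<Longrightarrow> spectrum (f U) = {x \<in> spectrum u. \<phi> x \<in> U}"
      using continuous_map_of_frame_hom[OF f] by auto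
    obtain \<psi> where \<psi>: "continuous_map (subtopology spectral_topology (spectrum top)) (top_of_set {0..1}) \<psi>"
      "\<And>x. x \<in> spectrum u \<Longrightarrow> \<psi> x = \<phi> x"
      using ext[rule_format, OF \<phi>(1)] by auto
    let ?g = "\<lambda>U. spectral_interior {x \<in> spectrum top. \<psi> x \<in> U} :: 'm"
    have "f U = inf (?g U) u" if U: "U \<in> opens_on {0..1}" for U
      using spectrum_subset[of u] \<psi>(2)
      by (subst spectrum_eq_iff[symmetric])
        (auto simp: spectrum_inf \<phi>(2)[OF U]
          spectrum_spectral_interior[OF openin_spectrum_preimage[OF \<psi>(1) U]])
    moreover have "frame_hom (opens_on {0..1}) UNIV ?g"
      using frame_hom_of_continuous_map[OF \<psi>(1)] by (simp add: atMost_def)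
    ultimately show "\<exists>g. frame_hom (opens_on {0..1}) UNIV g \<and> (\<forall>U\<in>opens_on {0..1}. f U = inf (g U) u)"
      by (intro exI[of _ ?g]) blast
  qed
qed

end

section \<open>Extended real functions and operations on the reals\<close>

text \<open>Points where \<open>\<phi>\<close> is infinite belong to no preimage, so this respects
  the top element only if \<open>q\<close> sends the finiteness set to \<open>top\<close>. Taking
  \<open>id\<close> for \<open>q\<close> keeps the preimages in the frame of \<open>\<phi>\<close>
  itself.\<close>

definition real_part_hom ::
  "('m::frame \<Rightarrow> 'l) \<Rightarrow> (('m \<Rightarrow> bool) \<Rightarrow> ereal) \<Rightarrow> real set \<Rightarrow> 'l" where
  "real_part_hom q \<phi> =
    (\<lambda>V\<in>opens. q (spectral_interior {x \<in> spectrum top. \<phi> x \<in> ereal ` V}))"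

lemma real_part_hom_apply:
  "V \<in> opens \<Longrightarrow> real_part_hom q \<phi> V = q (spectral_interior {x \<in> spectrum top. \<phi> x \<in> ereal ` V})"
  by (simp add: real_part_hom_def)

lemma openin_continuous_preimage:
  fixes \<phi> :: "('m::frame \<Rightarrow> bool) \<Rightarrow> 't::topological_space"
  assumes "continuous_map spectral_topology euclidean \<phi>" "open U"
  shows "openin spectral_topology {x \<in> spectrum top. \<phi> x \<in> U}"
  using openin_continuous_map_preimage[OF assms(1), of U] assms(2) by simp

text \<open>A rescaled arctangent \<open>s\<close> identifies the extended line with the unit
  interval, the infinite values going to the endpoints; \<open>\<sigma>\<close> is the rescaled
  tangent that undoes it.\<close>

lemma ereal_unit_interval:
  obtains s :: "ereal \<Rightarrow> real" and \<sigma> where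
    "continuous_on UNIV s" "\<And>t. s t \<in> {0..1}" "\<And>t. s t \<in> {0, 1} \<longleftrightarrow> t \<notin> range ereal"
    "continuous_on {0..1} \<sigma>" "\<And>t. \<sigma> (s t) = t"
proof -
  define s :: "ereal \<Rightarrow> real" where
    "s t = (if t = \<infinity> then 1 else if t = -\<infinity> then 0 else arctan (real_of_ereal t) / pi + 1 / 2)" for t
  define \<sigma> where "\<sigma> y = (if y \<le> 0 then -\<infinity> else if y \<ge> 1 then \<infinity> else ereal (tan (pi * (y - 1 / 2))))"
    for y :: real
  have bnd: "0 < arctan r / pi + 1 / 2" "arctan r / pi + 1 / 2 < 1" for r
    using arctan_lbound[of r] arctan_ubound[of r] by (auto simp: field_simps)
  have s01: "s t \<in> {0..1}" for t
    using bnd[of "real_of_ereal t"] by (simp add: s_def)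
  have s_end: "s t \<in> {0, 1} \<longleftrightarrow> t \<notin> range ereal" for t
  proof (cases t)
    case (real r)
    then show ?thesis using bnd[of r] by (simp add: s_def)
  qed (auto simp: s_def)
  have \<sigma>s: "\<sigma> (s t) = t" for t
  proof (cases t)
    case (real r)
    have "pi * (arctan r / pi + 1 / 2 - 1 / 2) = arctan r" by simp
    then show ?thesis using real bnd[of r] by (simp add: s_def \<sigma>_def tan_arctan)
  qed (auto simp: s_def \<sigma>_def)
  have angle: "- (pi / 2) < pi * (y - 1 / 2)" "pi * (y - 1 / 2) < pi / 2" if "0 < y" "y < 1" for y :: real
  proof -
    have "0 < pi * y" "pi * y < pi" using that by auto
    then show "- (pi / 2) < pi * (y - 1 / 2)" "pi * (y - 1 / 2) < pi / 2"
      by (simp_all add: right_diff_distrib)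
  qed
  have s\<sigma>: "s (\<sigma> y) = y" if "y \<in> {0..1}" for y
  proof (cases "0 < y \<and> y < 1")
    case True
    then show ?thesis using angle[of y] by (simp add: s_def \<sigma>_def arctan_tan)
  qed (use that in \<open>auto simp: s_def \<sigma>_def\<close>)
  have "UNIV = \<sigma> ` {0..1}"
    using \<sigma>s s01 by (metis UNIV_eq_I image_eqI)
  \<comment> \<open>A monotone function with open image is continuous, and the image here is the
    whole extended line. Compactness of the interval then makes the inverse \<open>s\<close>
    continuous as well.\<close>
  have cont: "continuous_on {0..1} \<sigma>"
  proof (rule continuous_onI_mono)
    show "open (\<sigma> ` {0..1})" using \<open>UNIV = _\<close> by simp
    fix x y :: real assume "x \<in> {0..1}" "y \<in> {0..1}" "x \<le> y"
    show "\<sigma> x \<le> \<sigma> y"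
    proof (cases "0 < x \<and> y < 1 \<and> x < y")
      case True
      then show ?thesis using angle[of x] angle[of y] by (auto simp: \<sigma>_def intro!: less_imp_le tan_monotone)
    qed (use \<open>x \<le> y\<close> in \<open>auto simp: \<sigma>_def\<close>)
  qed
  moreover have "continuous_on UNIV s"
    unfolding \<open>UNIV = _\<close> using s\<sigma> by (intro continuous_on_inv[OF cont]) auto
  ultimately show ?thesis using that s01 s_end \<sigma>s by blast
qed

lemma continuous_on_trunc_op: "trunc_op n w \<Longrightarrow> continuous_on UNIV w"
  by (cases rule: trunc_op.cases) (auto intro!: continuous_intros)

lemma trunc_op_local: "trunc_op n w \<Longrightarrow> (\<And>i. i < n \<Longrightarrow> x i = y i) \<Longrightarrow> w x = w y"
  by (cases rule: trunc_op.cases) auto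

lemma trunc_op_0: "trunc_op n w \<Longrightarrow> w (\<lambda>i. 0) = 0"
  by (cases rule: trunc_op.cases) auto

lemma trunc_op_neighbourhood:
  assumes w: "trunc_op n w" and V: "open V" "w y \<in> V"
  shows "\<exists>U. (\<forall>i. open (U i) \<and> y i \<in> U i) \<and> w ` PiE {..<n} U \<subseteq> V"
proof -
  have "open (w -` V)" using continuous_on_trunc_op[OF w] V(1) by (simp add: open_vimage)
  then have "openin (product_topology (\<lambda>i. euclidean) UNIV) (w -` V)" by (simp add: open_fun_def)
  from product_topology_open_contains_basis[OF this, of y] V(2) obtain X where
    X: "y \<in> PiE UNIV X" "\<And>i. open (X i)" "PiE UNIV X \<subseteq> w -` V" by auto
  have "w z \<in> V" if z: "z \<in> PiE {..<n} X" for z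
  proof -
    \<comment> \<open>The box \<open>X\<close> restricts every coordinate, whereas \<open>z\<close>
      is controlled only below \<open>n\<close>. Filling up with \<open>y\<close> stays in the box
      and does not change the value of \<open>w\<close>.\<close>
    have "(\<lambda>i. if i < n then z i else y i) \<in> PiE UNIV X"
      using z X(1) by (auto simp: PiE_def Pi_def)
    then have "w (\<lambda>i. if i < n then z i else y i) \<in> V" using X(3) by blast
    moreover have "w (\<lambda>i. if i < n then z i else y i) = w z"
      by (rule trunc_op_local[OF w]) simp
    ultimately show ?thesis by simp
  qed
  then show ?thesis using X by (intro exI[of _ X]) (auto simp: PiE_def Pi_def)
qed

text \<open>The topology of the extended reals is generated by rays. A preimage of a lower ray lies
  inside \<open>spectrum u\<close>, where \<open>b\<close> is continuous. For an upper ray, the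
  lower bound on \<open>b\<close> adds a whole neighbourhood of the zeros of
  \<open>c\<close>.\<close>

lemma continuous_map_pole:
  fixes u :: "'m::frame"
  assumes c: "continuous_map spectral_topology euclideanreal c"
    and spu: "spectrum u = {x \<in> spectrum top. c x \<noteq> 0}"
    and b: "continuous_map (subtopology spectral_topology (spectrum u)) euclideanreal b"
    and le: "\<And>x. x \<in> spectrum u \<Longrightarrow> 1 / \<bar>c x\<bar> + K \<le> b x"
  shows "continuous_map spectral_topology euclidean (\<lambda>x. if c x = 0 then \<infinity> else ereal (b x))"
    (is "continuous_map _ _ ?g")
proof -
  have b_open: "openin spectral_topology {x \<in> spectrum u. b x \<in> V}" if "open V" for V
    using openin_spectrum_preimage[of u UNIV b V] b that by (simp add: opens_on_def)
  have less: "openin spectral_topology {x \<in> spectrum top. ?g x < a}" for a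
  proof (cases a)
    case (real r)
    then have "{x \<in> spectrum top. ?g x < a} = {x \<in> spectrum u. b x \<in> {..<r}}" by (auto simp: spu)
    then show ?thesis using b_open[of "{..<r}"] by simp
  next
    case PInf
    then have "{x \<in> spectrum top. ?g x < a} = spectrum u" by (auto simp: spu)
    then show ?thesis by simp
  qed simp
  have greater: "openin spectral_topology {x \<in> spectrum top. a < ?g x}" for a
  proof (cases a)
    case (real r)
    \<comment> \<open>Chosen positive and above \<open>r - K\<close>, so that
      \<open>\<bar>c x\<bar> < 1 / m\<close> on \<open>spectrum u\<close> forces
      \<open>b x > r\<close>.\<close>
    define m where "m = max (r - K) 0 + 1"
    have m: "0 < m" "r - K < m" by (auto simp: m_def)
    have "r < b x" if "x \<in> spectrum u" "\<bar>c x\<bar> < 1 / m" for x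
    proof -
      have "m < 1 / \<bar>c x\<bar>" using that m(1) by (auto simp: spu field_simps)
      then show ?thesis using le[OF that(1)] m(2) by linarith
    qed
    then have "{x \<in> spectrum top. a < ?g x} =
        {x \<in> spectrum u. b x \<in> {r<..}} \<union> {x \<in> spectrum top. c x \<in> {- (1 / m)<..<1 / m}}"
      using m(1) real by (auto simp: spu abs_less_iff)
    then show ?thesis
      using b_open[of "{r<..}"] openin_continuous_preimage[OF c, of "{- (1 / m)<..<1 / m}"]
      by (simp add: openin_Un)
  next
    case MInf
    then have "{x \<in> spectrum top. a < ?g x} = spectrum top" by auto
    then show ?thesis by (metis openin_spectrum)
  qed simp
  have "openin spectral_topology {x \<in> spectrum top. ?g x \<in> U}" if "open U" for U
    using that unfolding open_generated_order
  proof (induction rule: generate_topology.induct)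
    case UNIV
    then show ?case by simp
  next
    case (Int A B)
    have "{x \<in> spectrum top. ?g x \<in> A \<inter> B} =
      {x \<in> spectrum top. ?g x \<in> A} \<inter> {x \<in> spectrum top. ?g x \<in> B}" by blast
    then show ?case using Int by (metis (no_types, lifting) openin_Int)
  next
    case (UN K)
    have "{x \<in> spectrum top. ?g x \<in> \<Union>K} = (\<Union>A\<in>K. {x \<in> spectrum top. ?g x \<in> A})" by blast
    then show ?case using UN by (metis (no_types, lifting) openin_Union imageE)
  next
    case (Basis A)
    then consider a where "A = {..<a}" | a where "A = {a<..}" by auto
    then show ?case
      by cases (simp_all only: lessThan_iff greaterThan_iff less greater)
  qed
  then show ?thesis by (simp add: continuous_map_def)
qed

section \<open>Compactifications and the function description of \<open>E0\<close>\<close>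

locale frame_compactification = compact_regular_frame M for M :: "'m::frame itself" +
  fixes pM :: "'m \<Rightarrow> bool" and pL :: "'l::frame \<Rightarrow> bool" and q :: "'m \<Rightarrow> 'l"
  assumes pM: "frame_point pM" and comp: "compactification pM pL q"
begin

lemma q_hom: "frame_hom UNIV UNIV q" and pL_q: "pL (q a) = pM a"
  and q_dense: "q a = bot \<Longrightarrow> a = bot"
  using comp by (auto simp: compactification_def pointed_frame_hom_def dense_hom_def)

lemmas q = frame_homD[OF q_hom]

lemma q_cong: "q u = top \<Longrightarrow> inf a u = inf b u \<Longrightarrow> q a = q b"
  using q(2)[of a u] q(2)[of b u] by simp

text \<open>The finiteness set is sent to \<open>top\<close>, so meeting with it does not change the
  image under \<open>q\<close>; the meet removes exactly the infinite values.\<close>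

lemma q_finite_part:
  assumes \<phi>: "continuous_map spectral_topology euclidean \<phi>" and U: "open U"
    and top: "q (spectral_interior {x \<in> spectrum top. \<phi> x \<in> range ereal}) = top"
  shows "q (spectral_interior {x \<in> spectrum top. \<phi> x \<in> U}) =
    q (spectral_interior {x \<in> spectrum top. \<phi> x \<in> ereal ` (ereal -` U)})"
    (is "q (?I U) = q (?I (ereal ` ?V))")
proof -
  have V: "open (ereal ` ?V)" using U by (intro open_ereal open_vimage continuous_intros)
  have sp: "spectrum (?I U) = {x \<in> spectrum top. \<phi> x \<in> U}" if "open U" for U
    by (simp add: spectrum_spectral_interior openin_continuous_preimage \<phi> that)
  have "inf (?I U) (?I (range ereal)) = ?I (ereal ` ?V)"
    by (subst spectrum_eq_iff[symmetric],
        unfold spectrum_inf sp[OF U] sp[OF V] sp[OF open_ereal[OF open_UNIV]]) auto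
  then show ?thesis using q(2)[of "?I U" "?I (range ereal)"] top by simp
qed

text \<open>\<open>q\<close> does not notice a meet with \<open>u\<close>, and by density it
  reflects \<open>bot\<close>. This supplies the density condition of \<open>D0\<close> from the
  finiteness condition in \<open>E0_iff\<close>.\<close>

lemma dense_element_of_q_top: "q u = top \<Longrightarrow> dense_element u"
  using q(2,4) q_dense unfolding dense_element_def by (metis inf_top_left)

lemma pM_in_spectrum: "pM \<in> spectrum a \<longleftrightarrow> pM a"
  using pM by (simp add: spectrum_def)

text \<open>An extension \<open>h'\<close> is the preimage map of a function \<open>\<phi>\<close>.
  Since open sets of reals are also open in the extended line, \<open>h\<close> is recovered from
  \<open>\<phi>\<close>, and its value on the whole real line gives the finiteness condition.
  Conversely the preimages under \<open>\<phi>\<close> define \<open>h'\<close>.\<close>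

lemma E0_iff:
  "h \<in> E0 pM pL q \<longleftrightarrow>
    (\<exists>\<phi>. continuous_map spectral_topology euclidean \<phi> \<and> \<phi> pM = 0 \<and>
      q (spectral_interior {x \<in> spectrum top. \<phi> x \<in> range ereal}) = top \<and> h = real_part_hom q \<phi>)"
    (is "_ \<longleftrightarrow> ?R")
proof
  assume "h \<in> E0 pM pL q"
  then obtain h' where h: "h \<in> R0 pL" and h': "h' \<in> D0 pM"
    and eq: "\<And>U. U \<in> opens \<Longrightarrow> q (h' U) = h (restr_real U)"
    unfolding E0_def by blast
  have "frame_hom (opens_on UNIV) {..top} h'"
    using h' by (simp add: D0_def pointed_frame_hom_def opens_on_UNIV atMost_def)
  from continuous_map_of_frame_hom[OF this] obtain \<phi> where
    \<phi>: "continuous_map spectral_topology euclidean \<phi>" and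
    sp': "\<forall>U\<in>opens. spectrum (h' U) = {x \<in> spectrum top. \<phi> x \<in> U}"
    by (auto simp: opens_on_UNIV)
  have sp: "{x \<in> spectrum top. \<phi> x \<in> U} = spectrum (h' U)" if "U \<in> opens" for U
    using sp' that by blast
  have hV: "h V = q (spectral_interior {x \<in> spectrum top. \<phi> x \<in> ereal ` V})" if "V \<in> opens" for V
  proof -
    have V: "ereal ` V \<in> opens" using that by (simp add: opens_def open_ereal)
    have "restr_real (ereal ` V) = V" by (auto simp: restr_real_def)
    then show ?thesis using eq[OF V] by (simp add: sp[OF V])
  qed
  have "\<phi> pM = 0"
  proof (rule ccontr)
    assume "\<phi> pM \<noteq> 0"
    \<comment> \<open>The base point would lie in the preimage of this set, yet pointedness of
      \<open>h'\<close> says that it does not, since the set omits \<open>0\<close>.\<close>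
    have U: "- {0::ereal} \<in> opens" by (simp add: opens_def open_Compl)
    have "pM \<in> spectrum (h' (- {0}))"
      using \<open>\<phi> pM \<noteq> 0\<close> pM by (simp add: sp[OF U, symmetric] spectrum_top)
    moreover have "pM (h' (- {0})) = zero_point (- {0::ereal})"
      using h' U unfolding D0_def pointed_frame_hom_def by blast
    ultimately show False by (simp add: zero_point_def pM_in_spectrum)
  qed
  moreover have "q (spectral_interior {x \<in> spectrum top. \<phi> x \<in> range ereal}) = h UNIV"
    using hV[of UNIV] by (simp add: opens_def)
  moreover have "h UNIV = top"
  proof -
    have "h (Sup opens) = Sup UNIV"
      using h unfolding R0_def pointed_frame_hom_def frame_hom_def by blast
    then show ?thesis unfolding frame_carrier_opens(2) by simp
  qed
  moreover have "h = real_part_hom q \<phi>"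
  proof (rule extensionalityI[of _ opens])
    show "h \<in> extensional opens" using h by (simp add: R0_def)
  qed (auto simp: real_part_hom_def hV)
  ultimately show ?R using \<phi> by (intro exI[of _ \<phi>]) simp
next
  assume ?R
  then obtain \<phi> where \<phi>: "continuous_map spectral_topology euclidean \<phi>" and \<phi>0: "\<phi> pM = 0"
    and top: "q (spectral_interior {x \<in> spectrum top. \<phi> x \<in> range ereal}) = top"
    and h: "h = real_part_hom q \<phi>" by blast
  let ?I = "\<lambda>U. spectral_interior {x \<in> spectrum top. \<phi> x \<in> U} :: 'm"
  define h' where "h' = (\<lambda>U\<in>opens. ?I U)"
  have sp: "spectrum (?I U) = {x \<in> spectrum top. \<phi> x \<in> U}" if "open U" for U
    by (simp add: spectrum_spectral_interior openin_continuous_preimage \<phi> that)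
  have fI: "frame_hom opens UNIV ?I"
    using frame_hom_of_continuous_map[of top UNIV \<phi>] \<phi> by (simp add: opens_on_UNIV atMost_def)
  have op: "Sup S \<in> opens" "x \<in> S \<Longrightarrow> x \<in> opens" if "S \<subseteq> opens" for S :: "'t::topological_space set set" and x
    using that by (auto simp: opens_def)
  have pMI: "pM (?I U) \<longleftrightarrow> 0 \<in> U" if "open U" for U
    using sp[OF that] pM_in_spectrum[of "?I U"] \<phi>0 pM by (auto simp: spectrum_top)
  have "frame_hom opens UNIV h'"
    using fI by (simp add: frame_hom_def h'_def opens_def open_Union open_Int subset_iff cong: image_cong)
  moreover have "dense_element (h' {-\<infinity><..<\<infinity>})"
  proof -
    have "{-\<infinity><..<\<infinity>} = range ereal"
    proof (intro set_eqI iffI)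
      fix t :: ereal assume "t \<in> {-\<infinity><..<\<infinity>}"
      then show "t \<in> range ereal" by (cases t) auto
    qed auto
    moreover have "open (range ereal)" using open_ereal[OF open_UNIV] .
    ultimately show ?thesis using top by (simp add: h'_def opens_def dense_element_of_q_top)
  qed
  ultimately have "h' \<in> D0 pM"
    by (auto simp: D0_def pointed_frame_hom_def h'_def pMI opens_def zero_point_def)
  moreover have "q (h' U) = h (restr_real U)" if "U \<in> opens" for U
  proof -
    have U: "open U" "open (restr_real U)"
      using that by (auto simp: opens_def restr_real_def intro!: open_vimage continuous_intros)
    have "q (?I U) = q (?I (ereal ` restr_real U))"
      unfolding restr_real_def using \<phi> U(1) top by (rule q_finite_part)
    then show ?thesis using U by (simp add: h h'_def real_part_hom_def opens_def)
  qed
  moreover have "h \<in> R0 pL"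
  proof -
    have "frame_hom opens UNIV h"
      unfolding frame_hom_def
    proof (intro conjI ballI allI impI)
      show "h (Sup opens) = Sup UNIV"
        using top by (simp add: h real_part_hom_def frame_carrier_opens(2)) (simp add: opens_def)
      show "h (inf U V) = inf (h U) (h V)" if "U \<in> opens" "V \<in> opens" for U V
      proof -
        have "?I (ereal ` (U \<inter> V)) = inf (?I (ereal ` U)) (?I (ereal ` V))"
          using that by (subst spectrum_eq_iff[symmetric])
            (auto simp: spectrum_inf sp open_ereal opens_def open_Int)
        then show ?thesis using that by (simp add: h real_part_hom_def opens_def open_Int q(2))
      qed
      show "h (Sup S) = Sup (h ` S)" if "S \<subseteq> opens" for S
      proof -
        have "spectrum (Sup ((\<lambda>V. ?I (ereal ` V)) ` S)) =
            (\<Union>V\<in>S. {x \<in> spectrum top. \<phi> x \<in> ereal ` V})"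
          using that by (auto simp: spectrum_Sup sp open_ereal opens_def subset_iff)
        also have "\<dots> = spectrum (?I (ereal ` \<Union>S))"
          using op(1)[OF that] by (subst sp) (auto simp: opens_def open_ereal)
        finally have "?I (ereal ` \<Union>S) = Sup ((\<lambda>V. ?I (ereal ` V)) ` S)"
          by (simp add: spectrum_eq_iff)
        moreover have "h V = q (?I (ereal ` V))" if "V \<in> S" for V
          using op(2) \<open>S \<subseteq> opens\<close> that by (auto simp: h real_part_hom_def)
        ultimately show ?thesis
          using op(1)[OF that] by (simp add: h real_part_hom_def q(3) image_image)
      qed
    qed simp
    then show ?thesis
      by (auto simp: R0_def pointed_frame_hom_def h real_part_hom_def opens_def zero_point_def
          pL_q pMI open_ereal)
  qed
  ultimately show "h \<in> E0 pM pL q" unfolding E0_def by blast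
qed

section \<open>Lifted operations act pointwise\<close>

text \<open>The formula for \<open>lift_op\<close> uses only finite meets and arbitrary joins, both
  preserved by \<open>q\<close>. Operations can therefore be computed in \<open>M\<close>
  first.\<close>

lemma lift_op_real_part_hom:
  assumes "\<And>i. i < n \<Longrightarrow> f i = real_part_hom q (\<phi> i)" and V: "V \<in> opens"
  shows "lift_op n w f V = q (lift_op n w (\<lambda>i. real_part_hom id (\<phi> i)) V)"
proof -
  let ?Us = "{U. (\<forall>i<n. U i \<in> opens) \<and> w ` PiE {..<n} U \<subseteq> V}"
  have "(INF i\<in>{..<n}. f i (U i)) = q (INF i\<in>{..<n}. real_part_hom id (\<phi> i) (U i))"
    if "U \<in> ?Us" for U
  proof -
    have "(INF i\<in>{..<n}. f i (U i)) = (INF i\<in>{..<n}. q (real_part_hom id (\<phi> i) (U i)))"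
      using that assms(1) by (intro INF_cong) (simp_all add: real_part_hom_apply)
    then show ?thesis by (simp only: frame_hom_finite_INF[OF q_hom finite_lessThan])
  qed
  then have "(SUP U\<in>?Us. INF i\<in>{..<n}. f i (U i)) =
      q (SUP U\<in>?Us. INF i\<in>{..<n}. real_part_hom id (\<phi> i) (U i))"
    unfolding q(3) image_image by (rule SUP_cong[OF refl])
  then show ?thesis using V by (simp add: lift_op_def setcompr_eq_image)
qed

text \<open>A point in some admissible box has its values mapped into \<open>V\<close>. Conversely,
  continuity of \<open>w\<close> puts an admissible box around the finite values at the
  point.\<close>

lemma spectrum_lift_op:
  fixes \<phi> :: "nat \<Rightarrow> ('m \<Rightarrow> bool) \<Rightarrow> ereal"
  assumes w: "trunc_op n w" and V: "V \<in> opens"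
    and \<phi>: "\<And>i. i < n \<Longrightarrow> continuous_map spectral_topology euclidean (\<phi> i)"
  shows "spectrum (lift_op n w (\<lambda>i. real_part_hom id (\<phi> i)) V) =
    {x \<in> spectrum top. (\<forall>i<n. \<phi> i x \<in> range ereal) \<and> w (\<lambda>i. real_of_ereal (\<phi> i x)) \<in> V}"
    (is "_ = ?W")
proof -
  have sp: "spectrum (real_part_hom id (\<phi> i) U) = {x \<in> spectrum top. \<phi> i x \<in> ereal ` U}"
    if "i < n" "U \<in> opens" for i U
    using that \<phi>
    by (simp add: real_part_hom_apply spectrum_spectral_interior openin_continuous_preimage open_ereal opens_def)
  have spI: "spectrum (INF i\<in>{..<n}. real_part_hom id (\<phi> i) (U i)) =
      {x \<in> spectrum top. \<forall>i<n. \<phi> i x \<in> ereal ` U i}" if "\<forall>i<n. U i \<in> opens" for U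
    using that by (auto simp: spectrum_finite_INF sp)
  let ?Us = "{U. (\<forall>i<n. U i \<in> opens) \<and> w ` PiE {..<n} U \<subseteq> V}"
  have "spectrum (lift_op n w (\<lambda>i. real_part_hom id (\<phi> i)) V) =
      (\<Union>U\<in>?Us. {x \<in> spectrum top. \<forall>i<n. \<phi> i x \<in> ereal ` U i})"
    using V spI by (auto simp: lift_op_def spectrum_Sup)
  also have "\<dots> = ?W"
  proof (intro set_eqI iffI)
    fix x assume "x \<in> (\<Union>U\<in>?Us. {x \<in> spectrum top. \<forall>i<n. \<phi> i x \<in> ereal ` U i})"
    then obtain U where U: "w ` PiE {..<n} U \<subseteq> V" and x: "x \<in> spectrum top"
      "\<And>i. i < n \<Longrightarrow> \<phi> i x \<in> ereal ` U i" by auto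
    have "real_of_ereal (\<phi> i x) \<in> U i" if "i < n" for i
      using x(2)[OF that] by auto
    \<comment> \<open>Members of \<open>PiE\<close> are \<open>undefined\<close> outside the index
      set, hence the restriction.\<close>
    then have "restrict (\<lambda>i. real_of_ereal (\<phi> i x)) {..<n} \<in> PiE {..<n} U"
      by (intro restrict_PiE_iff[THEN iffD2]) simp
    then have "w (restrict (\<lambda>i. real_of_ereal (\<phi> i x)) {..<n}) \<in> V"
      using U by blast
    moreover have "w (restrict (\<lambda>i. real_of_ereal (\<phi> i x)) {..<n}) = w (\<lambda>i. real_of_ereal (\<phi> i x))"
      by (rule trunc_op_local[OF w]) simp
    ultimately have "w (\<lambda>i. real_of_ereal (\<phi> i x)) \<in> V" by simp
    moreover have "\<phi> i x \<in> range ereal" if "i < n" for i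
      using x(2)[OF that] by blast
    ultimately show "x \<in> ?W" using x(1) by blast
  next
    fix x assume x: "x \<in> ?W"
    then obtain U where U: "\<And>i. open (U i)" "\<And>i. real_of_ereal (\<phi> i x) \<in> U i"
      "w ` PiE {..<n} U \<subseteq> V"
      using trunc_op_neighbourhood[OF w, of V "\<lambda>i. real_of_ereal (\<phi> i x)"] V
      by (auto simp: opens_def)
    have "\<phi> i x \<in> ereal ` U i" if "i < n" for i
    proof -
      have "\<phi> i x \<in> range ereal" using x that by blast
      then obtain t where "\<phi> i x = ereal t" by (rule rangeE)
      then show ?thesis using U(2)[of i] by simp
    qed
    then show "x \<in> (\<Union>U\<in>?Us. {x \<in> spectrum top. \<forall>i<n. \<phi> i x \<in> ereal ` U i})"
      using x U by (auto simp: opens_def)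
  qed
  finally show ?thesis .
qed

lemma pM_of_q_top: "q u = top \<Longrightarrow> pM u"
  using pL_q[of u] pL_q[of top] by (simp add: q(1) frame_pointD(1)[OF pM])

section \<open>C*-embedding implies closure under the operations\<close>

lemma trunc_closed_if_Cstar_embedded:
  assumes emb: "\<And>u::'m. cozero_element u \<Longrightarrow> q u = top \<Longrightarrow> Cstar_embedded u"
  shows "trunc_closed (E0 pM pL q)"
  unfolding trunc_closed_def
proof (intro allI impI)
  fix n w and f :: "nat \<Rightarrow> real set \<Rightarrow> 'l"
  assume w: "trunc_op n w" and fE: "\<forall>i<n. f i \<in> E0 pM pL q"
  let ?P = "\<lambda>i \<phi>. continuous_map spectral_topology euclidean \<phi> \<and> \<phi> pM = 0 \<and>
      q (spectral_interior {x \<in> spectrum top. \<phi> x \<in> range ereal}) = top \<and> f i = real_part_hom q \<phi>"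
  have "\<forall>i\<in>{..<n}. \<exists>\<phi>. ?P i \<phi>"
    using fE unfolding E0_iff by blast
  from bchoice[OF this] obtain \<phi> where P: "\<forall>i\<in>{..<n}. ?P i (\<phi> i)" by blast
  then have \<phi>: "\<And>i. i < n \<Longrightarrow> continuous_map spectral_topology euclidean (\<phi> i)"
    and \<phi>0: "\<And>i. i < n \<Longrightarrow> \<phi> i pM = 0"
    and top: "\<And>i. i < n \<Longrightarrow> q (spectral_interior {x \<in> spectrum top. \<phi> i x \<in> range ereal}) = top"
    and f: "\<And>i. i < n \<Longrightarrow> f i = real_part_hom q (\<phi> i)"
    by blast+
  \<comment> \<open>The part of \<open>M\<close> where all arguments are finite. For
    \<open>n = 0\<close> the empty meet makes it \<open>top\<close>.\<close>
  define u where "u = (INF i\<in>{..<n}. spectral_interior {x \<in> spectrum top. \<phi> i x \<in> range ereal})"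
  have qu: "q u = top"
  proof -
    have "q u = (INF i\<in>{..<n}. top)"
      unfolding u_def frame_hom_finite_INF[OF q_hom finite_lessThan]
      by (rule INF_cong) (simp_all only: top lessThan_iff)
    then show ?thesis by simp
  qed
  have spu: "spectrum u = {x \<in> spectrum top. \<forall>i<n. \<phi> i x \<in> range ereal}"
  proof -
    have "spectrum (spectral_interior {x \<in> spectrum top. \<phi> i x \<in> range ereal}) =
        {x \<in> spectrum top. \<phi> i x \<in> range ereal}" if "i < n" for i
      by (rule spectrum_spectral_interior, rule openin_continuous_preimage[OF \<phi>[OF that]])
        (rule open_ereal[OF open_UNIV])
    then show ?thesis unfolding u_def spectrum_finite_INF[OF finite_lessThan] by blast
  qed
  obtain s \<sigma> where s: "continuous_on UNIV s" "\<And>t::ereal. s t \<in> {0..1::real}"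
    "\<And>t. s t \<in> {0, 1} \<longleftrightarrow> t \<notin> range ereal"
    and \<sigma>: "continuous_on {0..1} \<sigma>" "\<And>t. \<sigma> (s t) = t"
    using ereal_unit_interval by blast
  have "cozero_element u"
    unfolding cozero_element_iff
  proof (intro exI conjI)
    have "continuous_map spectral_topology euclideanreal (\<lambda>x. s (\<phi> i x))" if "i < n" for i
      using continuous_map_compose[OF \<phi>[OF that], of euclideanreal s] s(1) by (simp add: o_def)
    \<comment> \<open>A factor vanishes exactly when \<open>s (\<phi> i x)\<close> is an endpoint,
      that is, when \<open>\<phi> i x\<close> is infinite.\<close>
    then show "continuous_map spectral_topology euclideanreal (\<lambda>x. \<Prod>i<n. s (\<phi> i x) * (1 - s (\<phi> i x)))"
      by (intro continuous_intros) auto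
    show "spectrum u = {x \<in> spectrum top. (\<Prod>i<n. s (\<phi> i x) * (1 - s (\<phi> i x))) \<noteq> 0}"
      using s(3) by (auto simp: spu)
  qed
  with qu have emb_u: "Cstar_embedded u" by (rule emb[rotated])
  define d where "d x = w (\<lambda>i. real_of_ereal (\<phi> i x))" for x
  let ?F = "lift_op n w (\<lambda>i. real_part_hom id (\<phi> i)) :: real set \<Rightarrow> 'm"
  have spF: "spectrum (?F V) = {x \<in> spectrum u. d x \<in> V}" if "V \<in> opens" for V
  proof -
    have "spectrum (?F V) = {x \<in> spectrum top. (\<forall>i<n. \<phi> i x \<in> range ereal) \<and>
        w (\<lambda>i. real_of_ereal (\<phi> i x)) \<in> V}"
      by (rule spectrum_lift_op[OF w that \<phi>])
    then show ?thesis by (simp only: d_def spu mem_Collect_eq conj_assoc)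
  qed
  have "continuous_map (subtopology spectral_topology (spectrum u)) euclideanreal d"
    unfolding continuous_map_def
  proof (intro conjI allI impI)
    fix V :: "real set" assume "openin euclidean V"
    then have "V \<in> opens" by (simp add: opens_def)
    from spF[OF this] have "openin spectral_topology {x \<in> spectrum u. d x \<in> V}"
      by (metis openin_spectrum)
    then show "openin (subtopology spectral_topology (spectrum u))
        {x \<in> topspace (subtopology spectral_topology (spectrum u)). d x \<in> V}"
      by (simp add: openin_open_subtopology)
  qed simp
  moreover have "continuous_map euclideanreal (top_of_set {0..1}) (\<lambda>r. s (ereal r))"
  proof -
    have "continuous_on UNIV (\<lambda>r. s (ereal r))"
      by (rule continuous_on_compose2[OF s(1) continuous_on_ereal[OF continuous_on_id]]) simp
    moreover have "(\<lambda>r. s (ereal r)) \<in> UNIV \<rightarrow> {0..1}" using s(2) by blast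
    ultimately show ?thesis by (simp add: continuous_map_in_subtopology)
  qed
  ultimately have "continuous_map (subtopology spectral_topology (spectrum u)) (top_of_set {0..1})
      ((\<lambda>r. s (ereal r)) \<circ> d)"
    by (rule continuous_map_compose)
  from emb_u[unfolded Cstar_embedded_iff, rule_format, OF this] obtain e where
    e: "continuous_map spectral_topology (top_of_set {0..1}) e"
    "\<And>x. x \<in> spectrum u \<Longrightarrow> e x = s (ereal (d x))"
    unfolding comp_apply by blast
  \<comment> \<open>The extension \<open>e\<close> may reach the endpoints outside
    \<open>spectrum u\<close>; unsquashing turns these into infinite values.\<close>
  define \<psi> where "\<psi> = \<sigma> \<circ> e"
  have \<psi>: "continuous_map spectral_topology euclidean \<psi>"
    unfolding \<psi>_def using e(1) \<sigma>(1) by (auto intro: continuous_map_compose)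
  have \<psi>u: "\<psi> x = ereal (d x)" if "x \<in> spectrum u" for x
    using e(2)[OF that] \<sigma>(2) by (simp add: \<psi>_def)
  have sp\<psi>: "spectrum (spectral_interior {x \<in> spectrum top. \<psi> x \<in> ereal ` V}) =
      {x \<in> spectrum top. \<psi> x \<in> ereal ` V}" if "open V" for V
    using that by (simp add: spectrum_spectral_interior openin_continuous_preimage \<psi> open_ereal)
  have "\<psi> pM = 0"
  proof -
    have "d pM = w (\<lambda>i. 0)"
      unfolding d_def by (rule trunc_op_local[OF w]) (simp add: \<phi>0)
    then show ?thesis
      using \<psi>u[of pM] pM_of_q_top[OF qu] by (simp add: pM_in_spectrum trunc_op_0[OF w])
  qed
  moreover have "q (spectral_interior {x \<in> spectrum top. \<psi> x \<in> range ereal}) = top"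
  proof -
    have "u \<le> spectral_interior {x \<in> spectrum top. \<psi> x \<in> range ereal}"
      using spectrum_subset[of u] \<psi>u
      by (subst spectrum_le_iff[symmetric], subst sp\<psi>) auto
    from q(5)[OF this] show ?thesis by (simp add: qu top_le)
  qed
  moreover have "lift_op n w f = real_part_hom q \<psi>"
  proof (rule extensionalityI[of _ opens])
    show "lift_op n w f \<in> extensional opens" "real_part_hom q \<psi> \<in> extensional opens"
      by (auto simp: lift_op_def real_part_hom_def)
    fix V :: "real set" assume V: "V \<in> opens"
    \<comment> \<open>Agreement on \<open>spectrum u\<close> suffices, because
      \<open>q u = top\<close> means that \<open>q\<close> depends only on the part below
      \<open>u\<close>.\<close>
    have "\<psi> x \<in> ereal ` V \<longleftrightarrow> d x \<in> V" if "x \<in> spectrum u" for x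
      by (auto simp: \<psi>u[OF that])
    then have "{x \<in> spectrum u. d x \<in> V} \<inter> spectrum u =
        {x \<in> spectrum top. \<psi> x \<in> ereal ` V} \<inter> spectrum u"
      using spectrum_subset[of u] by blast
    moreover have "open V" using V by (simp add: opens_def)
    ultimately have "inf (?F V) u = inf (spectral_interior {x \<in> spectrum top. \<psi> x \<in> ereal ` V}) u"
      by (subst spectrum_eq_iff[symmetric]) (simp only: spectrum_inf spF[OF V] sp\<psi>)
    then have "q (?F V) = q (spectral_interior {x \<in> spectrum top. \<psi> x \<in> ereal ` V})"
      by (rule q_cong[OF qu])
    moreover have "lift_op n w f V = q (?F V)"
      by (rule lift_op_real_part_hom[OF f V])
    ultimately show "lift_op n w f V = real_part_hom q \<psi> V"
      using V by (simp add: real_part_hom_apply)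
  qed
  ultimately show "lift_op n w f \<in> E0 pM pL q"
    unfolding E0_iff using \<psi> by (intro exI[of _ \<psi>] conjI)
qed

section \<open>Closure under addition implies C*-embedding\<close>

text \<open>A dense frame homomorphism is cancellable against maps into Hausdorff spaces.\<close>

lemma real_part_hom_unique:
  assumes \<phi>: "continuous_map spectral_topology euclidean \<phi>"
    and top: "q (spectral_interior {x \<in> spectrum top. \<phi> x \<in> range ereal}) = top"
    and d: "continuous_map (subtopology spectral_topology (spectrum u)) euclideanreal d"
    and eq: "\<And>V. open V \<Longrightarrow> q (spectral_interior {x \<in> spectrum top. \<phi> x \<in> ereal ` V}) =
      q (spectral_interior {x \<in> spectrum u. d x \<in> V})"
    and x: "x \<in> spectrum u"
  shows "\<phi> x = ereal (d x)"
proof (rule ccontr)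
  assume "\<phi> x \<noteq> ereal (d x)"
  then obtain U U' where U: "open U" "open U'" "\<phi> x \<in> U" "ereal (d x) \<in> U'" "U \<inter> U' = {}"
    by (meson hausdorff)
  let ?I = "\<lambda>U. spectral_interior {x \<in> spectrum top. \<phi> x \<in> U} :: 'm"
  let ?J = "\<lambda>V. spectral_interior {x \<in> spectrum u. d x \<in> V} :: 'm"
  have I: "spectrum (?I U) = {x \<in> spectrum top. \<phi> x \<in> U}" if "open U" for U
    by (simp add: spectrum_spectral_interior openin_continuous_preimage \<phi> that)
  have J: "spectrum (?J V) = {x \<in> spectrum u. d x \<in> V}" if "open V" for V
    using openin_spectrum_preimage[of u UNIV d V] d that
    by (simp add: spectrum_spectral_interior opens_on_def)
  have V: "open (ereal -` U)" "open (ereal -` U')"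
    using U by (auto intro!: open_vimage continuous_intros)
  have "q (?I U) = q (?I (ereal ` (ereal -` U)))"
    using \<phi> U(1) top by (rule q_finite_part)
  also have "\<dots> = q (?J (ereal -` U))" using V(1) by (rule eq)
  \<comment> \<open>Under \<open>q\<close> the preimage of \<open>U\<close> by \<open>\<phi>\<close>
    is replaced by the one by \<open>d\<close>, which is disjoint from the preimage of
    \<open>U'\<close> by \<open>d\<close>. Density of \<open>q\<close> carries this disjointness
    back to \<open>M\<close>, contradicting the presence of \<open>x\<close>.\<close>
  finally have "q (inf (?I U) (?J (ereal -` U'))) = q (inf (?J (ereal -` U)) (?J (ereal -` U')))"
    by (simp add: q(2))
  moreover have "inf (?J (ereal -` U)) (?J (ereal -` U')) = bot"
  proof -
    have "{x \<in> spectrum u. d x \<in> ereal -` U} \<inter> {x \<in> spectrum u. d x \<in> ereal -` U'} = {}"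
      using U(5) by blast
    then have "spectrum (inf (?J (ereal -` U)) (?J (ereal -` U'))) = spectrum bot"
      unfolding spectrum_inf J[OF V(1)] J[OF V(2)] spectrum_bot .
    then show ?thesis by (rule spectrum_eq_iff[THEN iffD1])
  qed
  ultimately have "q (inf (?I U) (?J (ereal -` U'))) = bot" by (simp only: q(4))
  then have "inf (?I U) (?J (ereal -` U')) = bot" by (rule q_dense)
  then have "spectrum (?I U) \<inter> spectrum (?J (ereal -` U')) = {}"
    unfolding spectrum_inf[symmetric] by simp
  moreover have "x \<in> spectrum (?I U) \<inter> spectrum (?J (ereal -` U'))"
    unfolding I[OF U(1)] J[OF V(2)] using x U(3,4) subsetD[OF spectrum_subset x] by simp
  ultimately show False by blast
qed

lemma Cstar_embedded_if_trunc_closed: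
  assumes closed: "trunc_closed (E0 pM pL q)"
    and "cozero_element u" and qu: "q u = top"
  shows "Cstar_embedded u"
  unfolding Cstar_embedded_iff
proof (intro allI impI)
  fix f :: "('m \<Rightarrow> bool) \<Rightarrow> real"
  assume f01: "continuous_map (subtopology spectral_topology (spectrum u)) (top_of_set {0..1}) f"
  then have f: "continuous_map (subtopology spectral_topology (spectrum u)) euclideanreal f"
    and f_range: "\<And>x. x \<in> spectrum u \<Longrightarrow> f x \<in> {0..1}"
    by (auto simp: continuous_map_in_subtopology)
  obtain c where c: "continuous_map spectral_topology euclideanreal c"
    and spu: "spectrum u = {x \<in> spectrum top. c x \<noteq> 0}"
    using \<open>cozero_element u\<close> cozero_element_iff by blast
  have pu: "pM \<in> spectrum u" using pM_of_q_top[OF qu] by (simp add: pM_in_spectrum)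
  then have cp: "c pM \<noteq> 0" by (simp add: spu)
  have inv: "continuous_map (subtopology spectral_topology (spectrum u)) euclideanreal (\<lambda>x. 1 / \<bar>c x\<bar>)"
    using continuous_map_from_subtopology[OF c]
    by (intro continuous_intros) (auto simp: spu)
  define k where "k = 1 / \<bar>c pM\<bar>"
  define G where "G b = (\<lambda>x. if c x = 0 then \<infinity> else ereal (b x))" for b :: "('m \<Rightarrow> bool) \<Rightarrow> real"
  define b where "b = (\<lambda>x. 1 / \<bar>c x\<bar> - k)"
  \<comment> \<open>The two summands have opposite poles outside \<open>u\<close>, and their sum on
    \<open>u\<close> is \<open>f - f pM\<close>. Subtracting \<open>k\<close> and
    \<open>f pM\<close> makes both vanish at the base point.\<close>
  define \<phi> where "\<phi> i = (if i = 0 then G (\<lambda>x. b x + (f x - f pM)) else uminus \<circ> G b)" for i :: nat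
  have bcont: "continuous_map (subtopology spectral_topology (spectrum u)) euclideanreal b"
    unfolding b_def by (intro continuous_intros inv)
  then have "continuous_map (subtopology spectral_topology (spectrum u)) euclideanreal
      (\<lambda>x. b x + (f x - f pM))"
    by (intro continuous_intros f)
  then have "continuous_map spectral_topology euclidean (G (\<lambda>x. b x + (f x - f pM)))"
    unfolding G_def
  proof (rule continuous_map_pole[OF c spu])
    fix x assume "x \<in> spectrum u"
    \<comment> \<open>Only \<open>f x \<ge> 0\<close> enters this bound.\<close>
    from f_range[OF this] show "1 / \<bar>c x\<bar> + (- k - f pM) \<le> b x + (f x - f pM)" by (simp add: b_def)
  qed
  moreover have "continuous_map spectral_topology euclidean (G b)"
    unfolding G_def using bcont
  proof (rule continuous_map_pole[OF c spu])
    show "1 / \<bar>c x\<bar> + - k \<le> b x" for x by (simp add: b_def)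
  qed
  then have "continuous_map spectral_topology euclidean (uminus \<circ> G b)"
    by (rule continuous_map_compose) (simp add: continuous_uminus_ereal)
  ultimately have \<phi>: "continuous_map spectral_topology euclidean (\<phi> i)" for i
    by (simp add: \<phi>_def)
  have fin: "{x \<in> spectrum top. \<phi> i x \<in> range ereal} = spectrum u" for i
    unfolding spu by (auto simp: \<phi>_def G_def)
  have "real_part_hom q (\<phi> i) \<in> E0 pM pL q" for i
  proof -
    have "\<phi> i pM = 0" using cp by (simp add: \<phi>_def G_def b_def k_def)
    then show ?thesis using \<phi>[of i] qu unfolding E0_iff
      by (intro exI[of _ "\<phi> i"] conjI) (simp_all only: fin spectral_interior_spectrum)
  qed
  then have "lift_op 2 (\<lambda>x. x 0 + x 1) (\<lambda>i. real_part_hom q (\<phi> i)) \<in> E0 pM pL q"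
    using closed[unfolded trunc_closed_def, rule_format, OF trunc_op_add] by simp
  then obtain \<psi> where \<psi>: "continuous_map spectral_topology euclidean \<psi>"
    and \<psi>top: "q (spectral_interior {x \<in> spectrum top. \<psi> x \<in> range ereal}) = top"
    and lift: "lift_op 2 (\<lambda>x. x 0 + x 1) (\<lambda>i. real_part_hom q (\<phi> i)) = real_part_hom q \<psi>"
    unfolding E0_iff by blast
  define d where "d x = f x - f pM" for x
  have d: "continuous_map (subtopology spectral_topology (spectrum u)) euclideanreal d"
    unfolding d_def by (intro continuous_intros f)
  have "q (spectral_interior {x \<in> spectrum top. \<psi> x \<in> ereal ` V}) =
      q (spectral_interior {x \<in> spectrum u. d x \<in> V})" if "open V" for V
  proof -
    have V: "V \<in> opens" using that by (simp add: opens_def)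
    let ?F = "lift_op 2 (\<lambda>x. x 0 + x 1) (\<lambda>i. real_part_hom id (\<phi> i)) V :: 'm"
    have "spectrum ?F = {x \<in> spectrum top. (\<forall>i<2. \<phi> i x \<in> range ereal) \<and>
        real_of_ereal (\<phi> 0 x) + real_of_ereal (\<phi> 1 x) \<in> V}"
      by (rule spectrum_lift_op[OF trunc_op_add V \<phi>])
    also have "\<dots> = {x \<in> spectrum u. d x \<in> V}"
    proof -
      have "(\<forall>i<2. \<phi> i x \<in> range ereal) \<longleftrightarrow> x \<in> spectrum u" if "x \<in> spectrum top" for x
      proof -
        have "\<phi> i x \<in> range ereal \<longleftrightarrow> x \<in> spectrum u" for i
          using fin[of i] that by blast
        \<comment> \<open>After rewriting, the body no longer depends on \<open>i\<close>;
          \<open>pos2\<close> provides an index below \<open>2\<close>, so the quantifier is not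
          vacuous.\<close>
        then show ?thesis by (simp only:) (use pos2 in blast)
      qed
      moreover have "real_of_ereal (\<phi> 0 x) + real_of_ereal (\<phi> 1 x) = d x" if "x \<in> spectrum u" for x
        using that unfolding spu by (simp add: \<phi>_def G_def d_def)
      moreover have "x \<in> spectrum top" if "x \<in> spectrum u" for x
        using that by (rule subsetD[OF spectrum_subset])
      ultimately show ?thesis by (intro Collect_cong) metis
    qed
    finally have "spectral_interior (spectrum ?F) = spectral_interior {x \<in> spectrum u. d x \<in> V}"
      by (rule arg_cong)
    then have "?F = spectral_interior {x \<in> spectrum u. d x \<in> V}"
      by (simp only: spectral_interior_spectrum)
    moreover have "real_part_hom q \<psi> V = q ?F"
      unfolding lift[symmetric] by (rule lift_op_real_part_hom[OF refl V])
    ultimately show ?thesis by (simp only: real_part_hom_apply[OF V])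
  qed
  then have \<psi>u: "\<psi> x = ereal (d x)" if "x \<in> spectrum u" for x
    using that by (rule real_part_hom_unique[OF \<psi> \<psi>top d])
  \<comment> \<open>This clamps to the range where \<open>f - f pM\<close> takes its values, then
    undoes the shift. Clamping comes before \<open>real_of_ereal\<close> so that the latter is
    applied only to finite values, where it is continuous.\<close>
  define e where "e t = real_of_ereal (max (ereal (- f pM)) (min (ereal (1 - f pM)) t)) + f pM" for t
  have clamp: "\<exists>r\<in>{- f pM..1 - f pM}. max (ereal (- f pM)) (min (ereal (1 - f pM)) t) = ereal r" for t
    by (cases t) (auto simp: max_def min_def)
  have "continuous_on UNIV e"
    unfolding e_def
  proof (intro continuous_intros continuous_on_compose2[OF continuous_on_real])
    show "(\<lambda>t. max (ereal (- f pM)) (min (ereal (1 - f pM)) t)) ` UNIV \<subseteq> UNIV - {\<infinity>, - \<infinity>}"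
    proof (rule image_subsetI)
      show "max (ereal (- f pM)) (min (ereal (1 - f pM)) t) \<in> UNIV - {\<infinity>, - \<infinity>}" for t
        using clamp[of t] by (elim bexE) (simp only:, simp)
    qed
  qed
  moreover have "e t \<in> {0..1}" for t
    using clamp[of t] by (auto simp: e_def)
  ultimately have "continuous_map euclidean (top_of_set {0..1}) e"
    by (auto simp: continuous_map_in_subtopology)
  then have "continuous_map spectral_topology (top_of_set {0..1}) (e \<circ> \<psi>)"
    by (rule continuous_map_compose[OF \<psi>])
  moreover have "(e \<circ> \<psi>) x = f x" if "x \<in> spectrum u" for x
    using \<psi>u[OF that] f_range[OF that] by (simp add: e_def d_def max_def min_def)
  ultimately show "\<exists>\<psi>. continuous_map spectral_topology (top_of_set {0..1}) \<psi> \<and>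
      (\<forall>x\<in>spectrum u. \<psi> x = f x)" by blast
qed

end

theorem proposition6p1p1:
  fixes pM :: "'m::frame \<Rightarrow> bool"
    and pL :: "'l::frame \<Rightarrow> bool"
    and q :: "'m \<Rightarrow> 'l"
  assumes "frame_point pM"
    and "frame_point pL"
    and "compactification pM pL q"
  shows "trunc_closed (E0 pM pL q) \<longleftrightarrow>
    (\<forall>u::'m. cozero_element u \<and> q u = top \<longrightarrow> Cstar_embedded u)"
proof -
  interpret frame_compactification "TYPE('m)" pM pL q
    using assms by unfold_locales (auto simp: compactification_def)
  show ?thesis
    using trunc_closed_if_Cstar_embedded Cstar_embedded_if_trunc_closed by blast
qed

end
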